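(* Let $P^n$ be an $n$-colorable $n$-dimensional simple polytope with facets $F_1,\dots,F_m$, and let $h:[m]\to[n]$ be a selected proper coloring which associates to each facet $F_j$ the corresponding color $h(F_j)=h(j)$. Let $V$ be a vertex of $P^n$ and let $\{F_{\nu_i}\}_{i=1}^n$ be the collection of all facets of $P^n$ which contain $V$, indexed so that $h(\nu_i)=i$. Suppose that $P^n$ is covered by a family of $n$ closed sets, $P^n=\bigcup_{i=1}^n X_i$. Then for some $i$, a connected component of $X_i$ intersects both $F_{\nu_i}$ and some other facet $F_j\neq F_{\nu_i}$ of $P^n$ colored by the color $i$.
   Context: An $n$-dimensional convex polytope is simple if exactly $n$ facets (codimension-one faces) meet at each vertex. A proper coloring of a simple polytope $P^n$ with facets $F_1,\dots,F_m$ by $n$ colors is a map $h:[m]\to[n]$, where $[k]=\{1,\dots,k\}$, such that $h(i)\neq h(j)$ whenever $F_i\neq F_j$ are adjacent, i.e. share a face of codimension $2$ (equivalently $F_i\cap F_j\ne\emptyset$). $P^n$ is $n$-colorable if it admits a proper coloring by $n$ colors. *)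

theory Defs
  imports "HOL-Analysis.Analysis"
begin

definition simple_polytope :: "nat \<Rightarrow> 'a::euclidean_space set \<Rightarrow> bool" where
  "simple_polytope n P \<longleftrightarrow>
     polytope P \<and> aff_dim P = int n \<and>
     (\<forall>v. v extreme_point_of P \<longrightarrow> card {F. F facet_of P \<and> v \<in> F} = n)"

text \<open>The empty set is a face of every convex set and has affine dimension \<open>-1\<close>.  Requiring
  \<open>G \<noteq> {}\<close> excludes it as a common face; otherwise the two endpoints of a segment would be adjacent.\<close>

definition adjacent_facets :: "'a::euclidean_space set \<Rightarrow> 'a set \<Rightarrow> 'a set \<Rightarrow> bool" where
  "adjacent_facets P F F' \<longleftrightarrow>
     F facet_of P \<and> F' facet_of P \<and> F \<noteq> F' \<and>
     (\<exists>G. G \<noteq> {} \<and> G face_of F \<and> G face_of F' \<and> aff_dim G = aff_dim P - 2)"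

definition enumerates_facets :: "'a::euclidean_space set \<Rightarrow> nat \<Rightarrow> (nat \<Rightarrow> 'a set) \<Rightarrow> bool" where
  "enumerates_facets P m F \<longleftrightarrow> bij_betw F {1..m} {A. A facet_of P}"

definition proper_coloring ::
    "'a::euclidean_space set \<Rightarrow> nat \<Rightarrow> (nat \<Rightarrow> 'a set) \<Rightarrow> nat \<Rightarrow> (nat \<Rightarrow> nat) \<Rightarrow> bool" where
  "proper_coloring P m F n h \<longleftrightarrow>
     h \<in> {1..m} \<rightarrow> {1..n} \<and>
     (\<forall>i\<in>{1..m}. \<forall>j\<in>{1..m}. adjacent_facets P (F i) (F j) \<longrightarrow> h i \<noteq> h j)"

end

theory Submission
  imports Defs
begin

text \<open>If no component of \<open>X i\<close> joins \<open>F (\<nu> i)\<close> to the other facets of color \<open>i\<close>, then \<open>X i\<close>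
  splits into two closed pieces, and Urysohn's lemma gives a function \<open>u i\<close> that is \<open>-1\<close> on
  \<open>F (\<nu> i)\<close>, \<open>1\<close> on the other facets of color \<open>i\<close> and nonzero on \<open>X i\<close>. As the \<open>X i\<close> cover \<open>P\<close>, the
  \<open>u i\<close> have no common zero. Used as coordinates in the basis dual to the facet normals at the
  vertex \<open>V\<close>, they form a nowhere vanishing vector field on \<open>P\<close>, so by Brouwer's theorem the field
  points radially away from a given interior point \<open>p\<close> somewhere on the boundary. For \<open>p\<close> near \<open>V\<close>
  the prescribed signs on the facets exclude this. Simplicity also ensures that facets of equal
  color are disjoint: two facets which meet share a vertex, hence a face of codimension 2.\<close>

section \<open>Topological preliminaries: separation along components, continuity of maxima\<close>

text \<open>In a compact Hausdorff space, two closed sets not joined by any connected set lie in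
  complementary clopen sets. Urysohn's lemma separates these pieces, enlarged by \<open>A\<close>
  and \<open>B\<close>, so that only -1 and 1 occur as values on \<open>X\<close>.\<close>

lemma separating_function:
  fixes A B X :: "'a::euclidean_space set"
  assumes "compact X" "closed A" "closed B" "A \<inter> B = {}"
    and nocomp: "\<And>C. C \<in> components X \<Longrightarrow> C \<inter> A = {} \<or> C \<inter> B = {}"
  obtains u :: "'a \<Rightarrow> real" where "continuous_on UNIV u"
    "\<And>x. x \<in> A \<Longrightarrow> u x = -1" "\<And>x. x \<in> B \<Longrightarrow> u x = 1" "\<And>x. x \<in> X \<Longrightarrow> u x \<noteq> 0"
proof -
  have "separated_between (top_of_set X) (X \<inter> A) (X \<inter> B)"
  proof (rule cut_wire_fence_theorem)
    show "disjnt C (X \<inter> A) \<or> disjnt C (X \<inter> B)" if C: "connectedin (top_of_set X) C" for C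
    proof (cases "C = {}")
      case False
      have "connected C" "C \<subseteq> X"
        using C by (auto simp: connectedin_subtopology)
      then obtain D where "D \<in> components X" "C \<subseteq> D"
        using exists_component_superset[of C X] False by auto
      then show ?thesis
        using nocomp[of D] by (auto simp: disjnt_def)
    qed auto
  qed (use assms in \<open>auto simp: compact_space_subtopology Hausdorff_space_subtopology
          intro: closedin_closed_Int\<close>)
  then obtain U W where UW: "closedin (top_of_set X) U" "closedin (top_of_set X) W"
      "U \<union> W = X" "disjnt U W" "X \<inter> A \<subseteq> U" "X \<inter> B \<subseteq> W"
    by (auto simp: separated_between_alt)
  have "closed U" "closed W"
    using UW(1,2) \<open>compact X\<close> by (meson closedin_closed_trans compact_imp_closed)+
  then have cl: "closedin (top_of_set UNIV) (U \<union> A)" "closedin (top_of_set UNIV) (W \<union> B)"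
    using assms by auto
  \<comment> \<open>\<open>U\<close> and \<open>W\<close> lie in \<open>X\<close>, so a point of
    \<open>A\<close> in \<open>W\<close> would lie in \<open>X \<inter> A\<close>, hence in
    \<open>U\<close>; likewise for \<open>B\<close>.\<close>
  have "(U \<union> A) \<inter> (W \<union> B) = {}"
    using UW assms(4) unfolding disjnt_def by blast
  from Urysohn_local[OF cl this, of "-1::real" 1]
  obtain u :: "'a \<Rightarrow> real" where u: "continuous_on UNIV u"
    "\<And>x. x \<in> U \<union> A \<Longrightarrow> u x = -1" "\<And>x. x \<in> W \<union> B \<Longrightarrow> u x = 1"
    by metis
  have "u x \<noteq> 0" if "x \<in> X" for x
    using u(2)[of x] u(3)[of x] UW(3) that by force
  with u that show ?thesis by blast
qed

lemma continuous_on_Max: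
  fixes f :: "'i \<Rightarrow> 'a::topological_space \<Rightarrow> real"
  assumes "finite I" "I \<noteq> {}" "\<And>i. i \<in> I \<Longrightarrow> continuous_on S (f i)"
  shows "continuous_on S (\<lambda>x. Max ((\<lambda>i. f i x) ` I))"
  using assms
proof (induction I rule: finite_ne_induct)
  case (insert i I)
  then have "(\<lambda>x. Max ((\<lambda>i. f i x) ` insert i I)) = (\<lambda>x. max (f i x) (Max ((\<lambda>i. f i x) ` I)))"
    by simp
  with insert show ?case
    by (auto intro!: continuous_intros)
qed auto

section \<open>Linear algebra of dual vectors\<close>

text \<open>One equation at a time: cutting a subspace by a hyperplane through 0 costs at most one
  dimension.\<close>

lemma dim_Int_hyperplanes:
  fixes L :: "'a::euclidean_space set"
  assumes "subspace L" "finite I"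
  shows "dim L \<le> dim {x \<in> L. \<forall>i\<in>I. a i \<bullet> x = 0} + card I"
  using assms(2)
proof (induction I)
  case (insert i I)
  let ?M = "{x \<in> L. \<forall>i\<in>I. a i \<bullet> x = 0}"
  have eq: "{x \<in> L. \<forall>j\<in>insert i I. a j \<bullet> x = 0} = ?M \<inter> {x. a i \<bullet> x = 0}"
    by auto
  have sM: "subspace ?M"
    using assms(1) by (auto simp: subspace_def inner_right_distrib)
  have sN: "subspace (?M \<inter> {x. a i \<bullet> x = 0})"
    using subspace_inter[OF sM subspace_hyperplane] .
  \<comment> \<open>The common point 0 excludes an empty intersection, whose affine dimension would
    be -1.\<close>
  have "0 \<in> ?M \<inter> {x. a i \<bullet> x = 0}"
    using sN subspace_0 by blast
  then have "aff_dim (?M \<inter> {x. a i \<bullet> x = 0}) \<ge> aff_dim ?M - 1"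
    using aff_dim_affine_Int_hyperplane[OF subspace_imp_affine[OF sM], of "a i" 0] by (auto split: if_splits)
  then have "dim ?M \<le> dim (?M \<inter> {x. a i \<bullet> x = 0}) + 1"
    using sM sN by (simp add: aff_dim_subspace)
  then show ?case
    using insert unfolding eq by simp
qed auto

text \<open>Without the equation for \<open>j\<close> there are fewer equations than dimensions, so
  a nonzero solution exists. Injectivity makes \<open>a j\<close> nonzero on it, and scaling gives
  the dual vector.\<close>

lemma dual_vectors:
  fixes L :: "'a::euclidean_space set"
  assumes L: "subspace L" and I: "finite I" "card I = dim L"
    and inj: "\<And>x. x \<in> L \<Longrightarrow> (\<And>i. i \<in> I \<Longrightarrow> a i \<bullet> x = 0) \<Longrightarrow> x = 0"
  obtains e where "\<And>i. i \<in> I \<Longrightarrow> e i \<in> L"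
    "\<And>i j. i \<in> I \<Longrightarrow> j \<in> I \<Longrightarrow> a i \<bullet> e j = (if i = j then 1 else 0)"
proof -
  have "\<exists>e\<in>L. \<forall>i\<in>I. a i \<bullet> e = (if i = j then 1 else 0)" if j: "j \<in> I" for j
  proof -
    let ?M = "{x \<in> L. \<forall>i\<in>I - {j}. a i \<bullet> x = 0}"
    have "0 < card I" using j I(1) card_gt_0_iff by blast
    then have "dim ?M > 0"
      using dim_Int_hyperplanes[OF L, of "I - {j}" a] I j by simp
    then obtain x where x: "x \<in> ?M" "x \<noteq> 0"
      by (metis (no_types, lifting) dim_eq_0 less_irrefl singletonI subsetI)
    then have nz: "a j \<bullet> x \<noteq> 0"
      using inj[of x] by (metis (mono_tags, lifting) DiffI mem_Collect_eq singletonD)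
    show ?thesis
      using x nz L by (intro bexI[of _ "x /\<^sub>R (a j \<bullet> x)"]) (auto simp: subspace_scale)
  qed
  then show ?thesis
    using that by metis
qed

section \<open>Direction space of the affine hull\<close>

text \<open>The linear space parallel to the affine hull, written with differences so that it
  depends on no base point.\<close>

definition directions :: "'a::euclidean_space set \<Rightarrow> 'a set" where
  "directions P = {x - y | x y. x \<in> affine hull P \<and> y \<in> affine hull P}"

lemma directions_iff:
  assumes "p \<in> affine hull P"
  shows "d \<in> directions P \<longleftrightarrow> p + d \<in> affine hull P"
proof
  assume "d \<in> directions P"
  then obtain x y where "d = x - y" "x \<in> affine hull P" "y \<in> affine hull P"
    by (auto simp: directions_def)
  then show "p + d \<in> affine hull P"
    using mem_affine_3_minus[OF affine_affine_hull assms, of x y 1] by simp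
next
  assume "p + d \<in> affine hull P"
  then show "d \<in> directions P"
    unfolding directions_def using assms by force
qed

lemma directions_eq_translation:
  assumes "p \<in> affine hull P"
  shows "directions P = (+) (- p) ` (affine hull P)"
proof (intro set_eqI iffI)
  fix d
  assume "d \<in> directions P"
  then have "p + d \<in> affine hull P"
    by (simp add: directions_iff[OF assms])
  then show "d \<in> (+) (- p) ` (affine hull P)"
    by (intro image_eqI[of _ _ "p + d"]) auto
next
  fix d
  assume "d \<in> (+) (- p) ` (affine hull P)"
  then show "d \<in> directions P"
    by (auto simp: directions_iff[OF assms])
qed

lemma subspace_directions:
  assumes "p \<in> P"
  shows "subspace (directions P)"
  using assms affine_diffs_subspace[OF affine_affine_hull, of p P] directions_eq_translation[of p P]
  by (simp add: hull_inc)

lemma dim_directions: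
  assumes "p \<in> P"
  shows "int (dim (directions P)) = aff_dim P"
proof -
  have "int (dim (directions P)) = aff_dim (directions P)"
    using subspace_directions[OF assms] by (simp add: aff_dim_subspace)
  also have "\<dots> = aff_dim P"
    using assms by (simp only: directions_eq_translation[of p] hull_inc aff_dim_translation_eq aff_dim_affine_hull)
  finally show ?thesis .
qed

section \<open>Polytopes described by their facet inequalities\<close>

text \<open>One supporting half-space is chosen per facet. If \<open>P\<close> spans a proper affine
  subspace, a facet does not determine its normal even up to scaling, hence the choice functions
  \<open>a\<close> and \<open>b\<close>.\<close>

locale polytope_inequalities =
  fixes P :: "'a::euclidean_space set" and a :: "'a set \<Rightarrow> 'a" and b :: "'a set \<Rightarrow> real"
  assumes polytope: "polytope P"
    and facet_eq: "F facet_of P \<Longrightarrow> F = P \<inter> {x. a F \<bullet> x = b F}"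
    and facet_le: "F facet_of P \<Longrightarrow> x \<in> P \<Longrightarrow> a F \<bullet> x \<le> b F"

lemma polytope_inequalities_exist:
  assumes "polytope P"
  obtains a b where "polytope_inequalities P a b"
proof -
  have "\<exists>a b. F = P \<inter> {x. a \<bullet> x = b} \<and> P \<subseteq> {x. a \<bullet> x \<le> b}" if "F facet_of P" for F
    using facet_of_polyhedron[OF polytope_imp_polyhedron[OF assms] that] by metis
  then obtain a b where "\<And>F. F facet_of P \<Longrightarrow> F = P \<inter> {x. a F \<bullet> x = b F} \<and> P \<subseteq> {x. a F \<bullet> x \<le> b F}"
    by metis
  then show ?thesis
    using that[of a b] assms unfolding polytope_inequalities_def by blast
qed

context polytope_inequalities
begin

lemma finite_facets: "finite {F. F facet_of P}"
  using finite_polytope_facets polytope by blast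

lemma rel_frontier_eq: "rel_frontier P = \<Union>{F. F facet_of P}"
  using rel_frontier_of_polyhedron polytope polytope_imp_polyhedron by blast

lemma rel_interior_less:
  assumes "p \<in> rel_interior P" "F facet_of P"
  shows "a F \<bullet> p < b F"
proof -
  have "p \<in> P" "p \<notin> F"
    using assms rel_interior_of_polyhedron[OF polytope_imp_polyhedron[OF polytope]] by auto
  then show ?thesis
    using facet_eq[OF assms(2)] facet_le[OF assms(2)] by force
qed

text \<open>Otherwise the segment from a relative interior point \<open>p\<close> to
  \<open>y\<close> leaves \<open>P\<close> before \<open>y\<close>, through some facet
  \<open>F\<close>. The inequality of \<open>F\<close> is strict at \<open>p\<close> and weak at
  \<open>y\<close>, hence strict at the exit point, although that point lies on
  \<open>F\<close>.\<close>

lemma mem_if_facet_inequalities: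
  assumes y: "y \<in> affine hull P" and le: "\<And>F. F facet_of P \<Longrightarrow> a F \<bullet> y \<le> b F"
  shows "y \<in> P"
proof (rule ccontr)
  assume "y \<notin> P"
  have "P \<noteq> {}" using y by auto
  then obtain p where p: "p \<in> rel_interior P"
    using polytope polytope_imp_convex rel_interior_eq_empty by blast
  then have pP: "p \<in> P" using rel_interior_subset by blast
  from p \<open>y \<notin> P\<close> obtain d where d: "0 < d" "p + d *\<^sub>R (y - p) \<in> rel_frontier P"
    "\<And>e. \<lbrakk>0 \<le> e; e < d\<rbrakk> \<Longrightarrow> p + e *\<^sub>R (y - p) \<in> rel_interior P"
    using ray_to_rel_frontier[of P p "y - p"] y polytope pP
    by (metis add.commute diff_add_cancel polytope_imp_bounded right_minus_eq)
  \<comment> \<open>Parameters below \<open>d\<close> give points of \<open>P\<close>, while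
    parameter 1 gives \<open>y\<close>.\<close>
  have "d \<le> 1"
    using d(3)[of 1] \<open>y \<notin> P\<close> rel_interior_subset[of P] by force
  moreover have "rel_frontier P \<subseteq> P"
    using polytope by (simp add: rel_frontier_def polytope_imp_closed)
  ultimately have "d < 1"
    using d(2) \<open>y \<notin> P\<close> by (cases "d = 1") auto
  obtain F where F: "F facet_of P" "p + d *\<^sub>R (y - p) \<in> F"
    using d(2) rel_frontier_eq by auto
  have "a F \<bullet> p + d * (a F \<bullet> y - a F \<bullet> p) = b F"
    using F(2) by (subst (asm) facet_eq[OF F(1)]) (simp add: inner_right_distrib inner_diff_right)
  then have eq: "(1 - d) * (a F \<bullet> p) + d * (a F \<bullet> y) = b F"
    by (simp add: algebra_simps)
  have "(1 - d) * (a F \<bullet> p) < (1 - d) * b F" "d * (a F \<bullet> y) \<le> d * b F"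
    using rel_interior_less[OF p F(1)] le[OF F(1)] \<open>d < 1\<close> d(1) by auto
  then show False
    using eq by (simp add: algebra_simps)
qed

text \<open>If every normal were nonpositive on \<open>v\<close>, all inequalities would persist
  along the ray from \<open>p\<close> in direction \<open>v\<close>, against boundedness. This is
  what makes the gauge in the radial projection positive.\<close>

lemma exists_increasing_facet:
  assumes "p \<in> P" "v \<in> directions P" "v \<noteq> 0"
  obtains F where "F facet_of P" "a F \<bullet> v > 0"
proof (rule ccontr)
  assume "\<not> thesis"
  with that have neg: "\<And>F. F facet_of P \<Longrightarrow> a F \<bullet> v \<le> 0" by force
  have mem: "p + t *\<^sub>R v \<in> P" if "t \<ge> 0" for t
  proof (rule mem_if_facet_inequalities)
    show "p + t *\<^sub>R v \<in> affine hull P"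
      using assms subspace_directions[OF assms(1)]
      by (metis directions_iff hull_inc subspace_scale)
    show "a F \<bullet> (p + t *\<^sub>R v) \<le> b F" if "F facet_of P" for F
      using facet_le[OF that assms(1)] mult_nonneg_nonpos[OF \<open>t \<ge> 0\<close> neg[OF that]]
      by (simp add: inner_right_distrib)
  qed
  obtain B where B: "\<And>x. x \<in> P \<Longrightarrow> norm x \<le> B"
    using polytope polytope_imp_bounded unfolding bounded_iff by blast
  \<comment> \<open>Long enough that \<open>p + t *\<^sub>R v\<close> has norm at least
    \<open>B + 1\<close>.\<close>
  define t where "t = (B + norm p + 1) / norm v"
  have B0: "B \<ge> 0" using B[OF assms(1)] norm_ge_zero order_trans by blast
  then have "t \<ge> 0" by (simp add: t_def)
  have "norm (t *\<^sub>R v) = B + norm p + 1"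
    using assms(3) B0 by (simp add: t_def)
  moreover have "norm (t *\<^sub>R v) \<le> norm (p + t *\<^sub>R v) + norm p"
    by (metis add.commute add_diff_cancel_left' norm_triangle_ineq4)
  ultimately show False
    using B[OF mem[OF \<open>t \<ge> 0\<close>]] by linarith
qed

text \<open>The radial projection onto the boundary is written explicitly through the gauge
  \<open>N v = Max {a F \<bullet> v / (b F - a F \<bullet> p)}\<close>; a Brouwer fixed point of \<open>x \<mapsto> p + w x / N (w x)\<close>
  is the required boundary point.\<close>

lemma field_radial_on_boundary:
  assumes p: "p \<in> rel_interior P"
    and cont: "continuous_on P w"
    and dir: "\<And>x. x \<in> P \<Longrightarrow> w x \<in> directions P"
    and nz: "\<And>x. x \<in> P \<Longrightarrow> w x \<noteq> 0"
  obtains x c where "x \<in> rel_frontier P" "c > 0" "x - p = c *\<^sub>R w x"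
proof -
  let ?I = "{F. F facet_of P}"
  define N where "N v = Max ((\<lambda>F. (a F \<bullet> v) / (b F - a F \<bullet> p)) ` ?I)" for v
  have pP: "p \<in> P" using p rel_interior_subset by blast
  \<comment> \<open>The nonzero direction \<open>w p\<close> forces a facet to exist, so the maximum
    in \<open>N\<close> is over a nonempty set.\<close>
  have ne: "?I \<noteq> {}"
    using exists_increasing_facet[OF pP dir[OF pP] nz[OF pP]] by (metis (mono_tags) empty_iff mem_Collect_eq)
  have gap: "b F - a F \<bullet> p > 0" if "F facet_of P" for F
    using rel_interior_less[OF p that] by simp
  have Nge: "(a F \<bullet> v) / (b F - a F \<bullet> p) \<le> N v" if "F facet_of P" for F v
    unfolding N_def using that finite_facets by (intro Max_ge) auto
  have Npos: "N v > 0" if v: "v \<in> directions P" "v \<noteq> 0" for v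
  proof -
    obtain F where F: "F facet_of P" "a F \<bullet> v > 0"
      using exists_increasing_facet[OF pP v] .
    then have "(a F \<bullet> v) / (b F - a F \<bullet> p) > 0"
      using gap by simp
    then show ?thesis using Nge[OF F(1), of v] by linarith
  qed
  have contN: "continuous_on UNIV N"
    unfolding N_def using gap finite_facets ne
    by (intro continuous_on_Max continuous_intros) force+
  define \<Phi> where "\<Phi> x = p + (1 / N (w x)) *\<^sub>R w x" for x
  have pos: "N (w x) > 0" if "x \<in> P" for x
    using Npos dir nz that by blast
  have into: "\<Phi> x \<in> P" if x: "x \<in> P" for x
  proof (rule mem_if_facet_inequalities)
    show "\<Phi> x \<in> affine hull P"
      unfolding \<Phi>_def using dir[OF x] subspace_directions[OF pP] pP
      by (metis directions_iff hull_inc subspace_scale)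
    fix F assume F: "F facet_of P"
    have "a F \<bullet> w x \<le> N (w x) * (b F - a F \<bullet> p)"
      using Nge[OF F, of "w x"] gap[OF F] by (simp add: field_simps)
    then show "a F \<bullet> \<Phi> x \<le> b F"
      using pos[OF x] by (simp add: \<Phi>_def inner_right_distrib field_simps)
  qed
  have "continuous_on P \<Phi>"
    unfolding \<Phi>_def using pos
    by (intro continuous_intros cont continuous_on_compose2[OF contN]) force+
  then obtain x where x: "x \<in> P" "\<Phi> x = x"
    using brouwer[of P \<Phi>] polytope polytope_imp_compact polytope_imp_convex pP into by blast
  \<comment> \<open>A facet attaining the maximum has its inequality tight at
    \<open>\<Phi> x\<close>, so the fixed point lies on the boundary.\<close>
  have "N (w x) \<in> (\<lambda>F. (a F \<bullet> w x) / (b F - a F \<bullet> p)) ` ?I"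
    unfolding N_def using finite_facets ne by (intro Max_in) auto
  then obtain F where F: "F facet_of P" "N (w x) = (a F \<bullet> w x) / (b F - a F \<bullet> p)"
    by blast
  have "a F \<bullet> w x = N (w x) * (b F - a F \<bullet> p)"
    using F gap[OF F(1)] by simp
  then have "a F \<bullet> \<Phi> x = b F"
    using pos[OF x(1)] by (simp add: \<Phi>_def inner_right_distrib)
  then have "x \<in> F"
    using x facet_eq[OF F(1)] by auto
  then have "x \<in> rel_frontier P"
    using F rel_frontier_eq by auto
  moreover have "x - p = (1 / N (w x)) *\<^sub>R w x"
    using x(2) unfolding \<Phi>_def by (metis add_diff_cancel_left')
  ultimately show ?thesis
    using that pos[OF x(1)] by (metis zero_less_divide_1_iff)
qed

section \<open>Facets at a vertex, and adjacency in simple polytopes\<close>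

lemma open_inactive: "open {x. \<forall>F. F facet_of P \<and> v \<notin> F \<longrightarrow> a F \<bullet> x < b F}"
proof -
  have "{x. \<forall>F. F facet_of P \<and> v \<notin> F \<longrightarrow> a F \<bullet> x < b F} =
      (\<Inter>F\<in>{F. F facet_of P \<and> v \<notin> F}. {x. a F \<bullet> x < b F})"
    by auto
  then show ?thesis
    using finite_facets by (auto intro!: open_INT open_halfspace_lt)
qed

text \<open>The inequalities of facets missing \<open>v\<close> stay strict on a ball around
  \<open>v\<close>, so only facets through \<open>v\<close> constrain short moves along
  \<open>d\<close> and \<open>- d\<close>.\<close>

lemma inactive_slack:
  assumes "v \<in> P"
  obtains t where "t > 0" "\<And>F. F facet_of P \<Longrightarrow> v \<notin> F \<Longrightarrow> a F \<bullet> (v + t *\<^sub>R d) < b F"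
    "\<And>F. F facet_of P \<Longrightarrow> v \<notin> F \<Longrightarrow> a F \<bullet> (v - t *\<^sub>R d) < b F"
proof -
  let ?U = "{x. \<forall>F. F facet_of P \<and> v \<notin> F \<longrightarrow> a F \<bullet> x < b F}"
  have "v \<in> ?U"
    using assms facet_le facet_eq by force
  then obtain r where r: "r > 0" "ball v r \<subseteq> ?U"
    using open_inactive open_contains_ball by blast
  \<comment> \<open>The summand 1 keeps the denominator positive when \<open>d = 0\<close>.\<close>
  define t where "t = r / (2 * (norm d + 1))"
  have t: "t > 0" using r by (simp add: t_def add_nonneg_pos)
  have "2 * (norm d + 1) > 0"
    by (simp add: add_nonneg_pos)
  then have "t * (2 * (norm d + 1)) = r"
    by (simp add: t_def)
  then have "t * norm d < r"
    using t r by (simp add: algebra_simps)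
  then have "v + t *\<^sub>R d \<in> ball v r" "v - t *\<^sub>R d \<in> ball v r"
    using t by (auto simp: dist_norm)
  then show ?thesis
    using that[OF t] r(2) by blast
qed

text \<open>A nonzero direction killed by all normals at \<open>v\<close> could be followed a little
  both ways inside \<open>P\<close>, making \<open>v\<close> the midpoint of a segment in
  \<open>P\<close>.\<close>

lemma extreme_point_normals_inj:
  assumes v: "v extreme_point_of P" and d: "d \<in> directions P"
    and zero: "\<And>F. F facet_of P \<Longrightarrow> v \<in> F \<Longrightarrow> a F \<bullet> d = 0"
  shows "d = 0"
proof (rule ccontr)
  assume "d \<noteq> 0"
  have vP: "v \<in> P" using v by (simp add: extreme_point_of_def)
  obtain t where t: "t > 0" "\<And>F. F facet_of P \<Longrightarrow> v \<notin> F \<Longrightarrow> a F \<bullet> (v + t *\<^sub>R d) < b F"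
    "\<And>F. F facet_of P \<Longrightarrow> v \<notin> F \<Longrightarrow> a F \<bullet> (v - t *\<^sub>R d) < b F"
    using inactive_slack[OF vP] by metis
  have "v + s *\<^sub>R d \<in> P" if s: "s = t \<or> s = - t" for s
  proof (rule mem_if_facet_inequalities)
    show "v + s *\<^sub>R d \<in> affine hull P"
      using d subspace_directions[OF vP] vP by (metis directions_iff hull_inc subspace_scale)
    show "a F \<bullet> (v + s *\<^sub>R d) \<le> b F" if F: "F facet_of P" for F
    proof (cases "v \<in> F")
      case True
      then show ?thesis
        using zero[OF F] facet_le[OF F vP] by (simp add: inner_right_distrib)
    next
      case False
      then show ?thesis
        using t(2,3)[OF F] s by force
    qed
  qed
  from this[of t] this[of "- t"] have "v + t *\<^sub>R d \<in> P" "v - t *\<^sub>R d \<in> P"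
    by auto
  moreover have "v \<in> open_segment (v + t *\<^sub>R d) (v - t *\<^sub>R d)"
  proof -
    have "v = midpoint (v + t *\<^sub>R d) (v - t *\<^sub>R d)"
      by (simp add: midpoint_def scaleR_2[symmetric])
    moreover have "v + t *\<^sub>R d \<noteq> v - t *\<^sub>R d"
    proof
      assume "v + t *\<^sub>R d = v - t *\<^sub>R d"
      then have "t *\<^sub>R d = - (t *\<^sub>R d)"
        by (metis add_left_imp_eq uminus_add_conv_diff add.commute)
      then show False
        using t(1) \<open>d \<noteq> 0\<close> by (metis eq_neg_iff_add_eq_0 scaleR_2 scaleR_eq_0_iff less_irrefl zero_neq_numeral)
    qed
    ultimately show ?thesis
      using midpoint_in_open_segment by metis
  qed
  ultimately show False
    using v by (auto simp: extreme_point_of_def)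
qed

text \<open>By simplicity the number of facets at \<open>v\<close> equals the dimension, so the
  injective family of normals is a basis of the dual of \<open>directions P\<close>. Geometrically,
  \<open>- e F\<close> points along the edge that leaves \<open>F\<close> within the other facets at
  \<open>v\<close>.\<close>

lemma dual_vectors_at_vertex:
  assumes simple: "simple_polytope n P" and v: "v extreme_point_of P"
  obtains e where "\<And>F. F facet_of P \<Longrightarrow> v \<in> F \<Longrightarrow> e F \<in> directions P"
    "\<And>F G. \<lbrakk>F facet_of P; v \<in> F; G facet_of P; v \<in> G\<rbrakk> \<Longrightarrow> a F \<bullet> e G = (if F = G then 1 else 0)"
proof -
  let ?I = "{F. F facet_of P \<and> v \<in> F}"
  have vP: "v \<in> P" using v by (simp add: extreme_point_of_def)
  have "finite ?I"
    using finite_facets by (rule rev_finite_subset) auto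
  moreover have "card ?I = dim (directions P)"
    using simple v dim_directions[OF vP] by (simp add: simple_polytope_def)
  moreover have "d = 0" if "d \<in> directions P" "\<And>F. F \<in> ?I \<Longrightarrow> a F \<bullet> d = 0" for d
    using extreme_point_normals_inj[OF v that(1)] that(2) by simp
  ultimately obtain e where "\<And>F. F \<in> ?I \<Longrightarrow> e F \<in> directions P"
    "\<And>F G. F \<in> ?I \<Longrightarrow> G \<in> ?I \<Longrightarrow> a F \<bullet> e G = (if F = G then 1 else 0)"
    using dual_vectors[OF subspace_directions[OF vP], of ?I a] by blast
  then show ?thesis
    by (intro that[of e]) auto
qed

text \<open>\<open>F \<inter> G\<close> lies in the flat \<open>A\<close> cut from the affine hull
  by the two hyperplanes, and contains a nonempty relatively open part of \<open>A\<close>, so the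
  dimensions agree. The dual vectors at a common vertex show that \<open>A\<close> has codimension
  2.\<close>

lemma aff_dim_Int_facets:
  assumes simple: "simple_polytope n P"
    and F: "F facet_of P" and G: "G facet_of P" and "F \<noteq> G" "F \<inter> G \<noteq> {}"
  shows "aff_dim (F \<inter> G) = aff_dim P - 2"
proof -
  have face: "F \<inter> G face_of P"
    using F G face_of_Int facet_of_imp_face_of by blast
  then have "compact (F \<inter> G)" "convex (F \<inter> G)"
    using face_of_polytope_polytope[OF polytope] polytope_imp_compact polytope_imp_convex by blast+
  then obtain v where "v extreme_point_of (F \<inter> G)"
    using extreme_point_exists_convex \<open>F \<inter> G \<noteq> {}\<close> by blast
  then have v: "v extreme_point_of P" "v \<in> F" "v \<in> G"
    using face extreme_point_of_face by blast+
  have vP: "v \<in> P" using v by (simp add: extreme_point_of_def)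
  obtain e where e: "\<And>H. H facet_of P \<Longrightarrow> v \<in> H \<Longrightarrow> e H \<in> directions P"
    "\<And>H K. \<lbrakk>H facet_of P; v \<in> H; K facet_of P; v \<in> K\<rbrakk> \<Longrightarrow> a H \<bullet> e K = (if H = K then 1 else 0)"
    using dual_vectors_at_vertex[OF simple v(1)] by blast
  define hp where "hp H = {x. a H \<bullet> x = b H}" for H
  define A where "A = affine hull P \<inter> hp F \<inter> hp G"
  have affA: "affine (affine hull P \<inter> hp F)" "affine A"
    unfolding A_def hp_def by (intro affine_Int affine_affine_hull affine_hyperplane)+
  have vhp: "a H \<bullet> v = b H" if "H facet_of P" "v \<in> H" for H
    using facet_eq that by blast
  have veF: "v + e F \<in> affine hull P" and veG: "v + e G \<in> affine hull P"
    using e(1) F G v vP by (metis directions_iff hull_inc)+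
  \<comment> \<open>\<open>v\<close> lies on the hyperplane of \<open>F\<close> and
    \<open>v + e F\<close> does not, so this cut lowers the dimension by exactly one. For the second
    cut, \<open>e G\<close> is tangent to the hyperplane of \<open>F\<close> but transversal to that
    of \<open>G\<close>.\<close>
  have "v \<in> affine hull P \<inter> hp F" "v + e F \<notin> hp F"
    using vP vhp[OF F v(2)] e(2)[OF F v(2) F v(2)] by (auto simp: hp_def hull_inc inner_right_distrib)
  then have 1: "aff_dim (affine hull P \<inter> hp F) = aff_dim P - 1"
    using veF aff_dim_affine_Int_hyperplane[OF affine_affine_hull, of P "a F" "b F"]
    unfolding hp_def by (auto split: if_splits)
  have "v \<in> A" "v + e G \<in> affine hull P \<inter> hp F" "v + e G \<notin> hp G"
    using vP vhp[OF F v(2)] vhp[OF G v(3)] e(2)[OF F v(2) G v(3)] e(2)[OF G v(3) G v(3)] veG \<open>F \<noteq> G\<close>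
    by (auto simp: A_def hp_def hull_inc inner_right_distrib)
  then have 2: "aff_dim A = aff_dim P - 2"
    using 1 aff_dim_affine_Int_hyperplane[OF affA(1), of "a G" "b G"]
    unfolding A_def hp_def by (auto split: if_splits)
  let ?J = "{H. H facet_of P \<and> v \<in> H} - {F, G}"
  let ?U = "\<Inter>H\<in>{H. H facet_of P} - {F, G}. {x. a H \<bullet> x < b H}"
  have finJ: "finite ?J"
    using finite_facets by (rule rev_finite_subset) auto
  \<comment> \<open>Moving against \<open>s\<close> leaves all other facets at \<open>v\<close> at
    once while staying on the hyperplanes of \<open>F\<close> and \<open>G\<close>. A short move
    gives the point \<open>z\<close> of \<open>A\<close> strictly inside all remaining
    half-spaces.\<close>
  define s where "s = (\<Sum>H\<in>?J. e H)"
  have s: "s \<in> directions P"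
    unfolding s_def using e(1) subspace_directions[OF vP] by (intro subspace_sum) auto
  have as: "a H \<bullet> s = (if H \<in> ?J then 1 else 0)" if "H facet_of P" "v \<in> H" for H
  proof -
    have "a H \<bullet> s = (\<Sum>K\<in>?J. if H = K then 1 else 0)"
      unfolding s_def inner_sum_right using e(2) that by (intro sum.cong) auto
    then show ?thesis using finJ by simp
  qed
  obtain t where t: "t > 0" "\<And>H. H facet_of P \<Longrightarrow> v \<notin> H \<Longrightarrow> a H \<bullet> (v - t *\<^sub>R s) < b H"
    using inactive_slack[OF vP] by metis
  define z where "z = v - t *\<^sub>R s"
  have "z = v + (- t) *\<^sub>R s" by (simp add: z_def)
  then have "z \<in> affine hull P"
    using s subspace_directions[OF vP] vP by (metis directions_iff hull_inc subspace_scale)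
  moreover have "a F \<bullet> z = b F" "a G \<bullet> z = b G"
    using as[OF F v(2)] as[OF G v(3)] vhp[OF F v(2)] vhp[OF G v(3)] by (auto simp: z_def inner_diff_right)
  ultimately have "z \<in> A"
    by (simp add: A_def hp_def)
  moreover have "z \<in> ?U"
  proof
    fix H assume H: "H \<in> {H. H facet_of P} - {F, G}"
    show "z \<in> {x. a H \<bullet> x < b H}"
    proof (cases "v \<in> H")
      case True
      then show ?thesis
        using H as[of H] vhp[of H] t(1) by (simp add: z_def inner_diff_right)
    next
      case False
      then show ?thesis
        using H t(2)[of H] by (simp add: z_def)
    qed
  qed
  ultimately have "A \<inter> ?U \<noteq> {}" by blast
  moreover have "open ?U"
    using finite_facets by (intro open_INT ballI open_halfspace_lt) auto
  ultimately have 3: "aff_dim (A \<inter> ?U) = aff_dim A"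
    using affine_imp_convex[OF affA(2)] by (intro aff_dim_convex_Int_open)
  have "A \<inter> ?U \<subseteq> P"
  proof
    fix x assume x: "x \<in> A \<inter> ?U"
    show "x \<in> P"
    proof (rule mem_if_facet_inequalities)
      show "x \<in> affine hull P" using x by (simp add: A_def)
      show "a H \<bullet> x \<le> b H" if "H facet_of P" for H
        using x that by (cases "H \<in> {F, G}") (auto simp: A_def hp_def less_imp_le)
    qed
  qed
  then have "A \<inter> ?U \<subseteq> F \<inter> G"
    using facet_eq[OF F] facet_eq[OF G] by (auto simp: A_def hp_def)
  then have "aff_dim A \<le> aff_dim (F \<inter> G)"
    using aff_dim_subset[of "A \<inter> ?U" "F \<inter> G"] by (simp only: 3)
  moreover have "F \<inter> G \<subseteq> A"
    by (subst facet_eq[OF F], subst facet_eq[OF G]) (auto simp: A_def hp_def hull_inc)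
  then have "aff_dim (F \<inter> G) \<le> aff_dim A"
    by (rule aff_dim_subset)
  ultimately show ?thesis
    using 2 by simp
qed

text \<open>The witness is the intersection itself; simplicity turns mere contact into the
  codimension 2 face that properness of a coloring refers to.\<close>

lemma adjacent_if_meet:
  assumes "simple_polytope n P" "F facet_of P" "G facet_of P" "F \<noteq> G" "F \<inter> G \<noteq> {}"
  shows "adjacent_facets P F G"
proof -
  have "F \<inter> G face_of F" "F \<inter> G face_of G"
    using assms face_of_Int face_of_face facet_of_imp_face_of by (metis inf_le1 inf_le2)+
  then show ?thesis
    unfolding adjacent_facets_def
    using assms(2-5) aff_dim_Int_facets[OF assms] by (intro conjI exI[of _ "F \<inter> G"])
qed

end

section \<open>Coverings of a colored simple polytope\<close>

theorem theorem6p1: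
  fixes P :: "'a::euclidean_space set"
    and n m :: nat
    and F X :: "nat \<Rightarrow> 'a set"
    and h \<nu> :: "nat \<Rightarrow> nat"
    and V :: 'a
  assumes "simple_polytope n P"
    and "enumerates_facets P m F"
    and "proper_coloring P m F n h"
    and "V extreme_point_of P"
    and "bij_betw \<nu> {1..n} {j \<in> {1..m}. V \<in> F j}"
    and "\<forall>i\<in>{1..n}. h (\<nu> i) = i"
    and "\<forall>i\<in>{1..n}. closed (X i)"
    and "P = (\<Union>i\<in>{1..n}. X i)"
  shows "\<exists>i\<in>{1..n}. \<exists>C\<in>components (X i).
           C \<inter> F (\<nu> i) \<noteq> {} \<and>
           (\<exists>j\<in>{1..m}. F j \<noteq> F (\<nu> i) \<and> h j = i \<and> C \<inter> F j \<noteq> {})"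
proof (rule ccontr)
  assume contra: "\<not> ?thesis"
  have poly: "polytope P"
    using assms(1) by (simp add: simple_polytope_def)
  then obtain a b where "polytope_inequalities P a b"
    using polytope_inequalities_exist by blast
  then interpret polytope_inequalities P a b .
  have VP: "V \<in> P"
    using assms(4) by (simp add: extreme_point_of_def)
  have facet: "F j facet_of P" if "j \<in> {1..m}" for j
    using assms(2) that unfolding enumerates_facets_def bij_betw_def by blast
  have facet_obtain: "\<exists>j\<in>{1..m}. G = F j" if "G facet_of P" for G
    using assms(2) that unfolding enumerates_facets_def bij_betw_def by blast
  define \<phi> where "\<phi> i = F (\<nu> i)" for i
  have \<nu>: "\<nu> i \<in> {1..m}" "V \<in> \<phi> i" "h (\<nu> i) = i" if "i \<in> {1..n}" for i
    using assms(5,6) that unfolding \<phi>_def bij_betw_def by blast+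
  have \<phi>: "\<phi> i facet_of P" if "i \<in> {1..n}" for i
    unfolding \<phi>_def using facet \<nu>(1) that by blast
  \<comment> \<open>\<open>h\<close> recovers \<open>i\<close> from \<open>\<nu> i\<close>, and
    \<open>F\<close> is injective on indices, so distinct colors give distinct facets at
    \<open>V\<close>.\<close>
  have \<phi>_eq_iff: "\<phi> i = \<phi> j \<longleftrightarrow> i = j" if "i \<in> {1..n}" "j \<in> {1..n}" for i j
  proof -
    have "inj_on F {1..m}"
      using assms(2) by (simp add: enumerates_facets_def bij_betw_def)
    then show ?thesis
      unfolding \<phi>_def using that \<nu> inj_onD by metis
  qed
  define K where "K i = (\<Union>j\<in>{j \<in> {1..m}. h j = i \<and> F j \<noteq> \<phi> i}. F j)" for i
  have K_sub: "K i \<subseteq> P" for i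
    unfolding K_def using facet facet_of_imp_subset by blast
  have compact_facet: "compact G" if "G facet_of P" for G
    using face_of_polytope_polytope[OF poly] facet_of_imp_face_of[OF that] polytope_imp_compact by blast
  have K_compact: "compact (K i)" for i
    unfolding K_def using facet compact_facet by (intro compact_UN) auto
  have disj: "\<phi> i \<inter> K i = {}" if i: "i \<in> {1..n}" for i
  proof -
    have "\<phi> i \<inter> F j = {}" if j: "j \<in> {1..m}" "h j = i" "F j \<noteq> \<phi> i" for j
    proof (rule ccontr)
      assume "\<phi> i \<inter> F j \<noteq> {}"
      then have "adjacent_facets P (F (\<nu> i)) (F j)"
        using adjacent_if_meet[OF assms(1) \<phi>[OF i] facet[OF j(1)]] j(3) by (auto simp: \<phi>_def)
      then have "h (\<nu> i) \<noteq> h j"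
        using assms(3) \<nu>(1)[OF i] j(1) by (simp add: proper_coloring_def)
      then show False
        using \<nu>(3)[OF i] j(2) by simp
    qed
    then show ?thesis
      unfolding K_def by blast
  qed
  have "\<forall>i\<in>{1..n}. \<exists>u :: 'a \<Rightarrow> real. continuous_on UNIV u \<and> (\<forall>x\<in>\<phi> i. u x = -1) \<and> (\<forall>x\<in>K i. u x = 1) \<and>
      (\<forall>x\<in>X i. u x \<noteq> 0)"
  proof
    fix i assume i: "i \<in> {1..n}"
    have "X i \<subseteq> P"
      using assms(8) i by blast
    then have "compact (X i)"
      using assms(7) i polytope_imp_bounded[OF poly] bounded_subset compact_eq_bounded_closed by blast
    moreover have "C \<inter> \<phi> i = {} \<or> C \<inter> K i = {}" if "C \<in> components (X i)" for C
      using contra i that unfolding K_def \<phi>_def by blast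
    ultimately obtain v :: "'a \<Rightarrow> real" where "continuous_on UNIV v"
      "\<And>x. x \<in> \<phi> i \<Longrightarrow> v x = -1" "\<And>x. x \<in> K i \<Longrightarrow> v x = 1" "\<And>x. x \<in> X i \<Longrightarrow> v x \<noteq> 0"
      using separating_function[OF _ compact_imp_closed[OF compact_facet[OF \<phi>[OF i]]]
          compact_imp_closed[OF K_compact] disj[OF i]] by blast
    then show "\<exists>u :: 'a \<Rightarrow> real. continuous_on UNIV u \<and> (\<forall>x\<in>\<phi> i. u x = -1) \<and> (\<forall>x\<in>K i. u x = 1) \<and>
        (\<forall>x\<in>X i. u x \<noteq> 0)"
      by blast
  qed
  from bchoice[OF this] obtain u :: "nat \<Rightarrow> 'a \<Rightarrow> real" where
    u: "\<And>i. i \<in> {1..n} \<Longrightarrow> continuous_on UNIV (u i)"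
      "\<And>i x. i \<in> {1..n} \<Longrightarrow> x \<in> \<phi> i \<Longrightarrow> u i x = -1"
      "\<And>i x. i \<in> {1..n} \<Longrightarrow> x \<in> K i \<Longrightarrow> u i x = 1"
      "\<And>i x. i \<in> {1..n} \<Longrightarrow> x \<in> X i \<Longrightarrow> u i x \<noteq> 0"
    by blast
  obtain e where e: "\<And>G. G facet_of P \<Longrightarrow> V \<in> G \<Longrightarrow> e G \<in> directions P"
    "\<And>G H. \<lbrakk>G facet_of P; V \<in> G; H facet_of P; V \<in> H\<rbrakk> \<Longrightarrow> a G \<bullet> e H = (if G = H then 1 else 0)"
    using dual_vectors_at_vertex[OF assms(1,4)] by blast
  define w where "w x = (\<Sum>i\<in>{1..n}. u i x *\<^sub>R e (\<phi> i))" for x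
  \<comment> \<open>By duality the normal of \<open>\<phi> i\<close> reads off the coordinate
    \<open>u i\<close> of the field.\<close>
  have aw: "a (\<phi> i) \<bullet> w x = u i x" if i: "i \<in> {1..n}" for i x
  proof -
    have "a (\<phi> i) \<bullet> w x = (\<Sum>j\<in>{1..n}. if i = j then u i x else 0)"
      unfolding w_def inner_sum_right
      using e(2)[OF \<phi>[OF i] \<nu>(2)[OF i] \<phi> \<nu>(2)] \<phi>_eq_iff[OF i] by (intro sum.cong) auto
    then show ?thesis
      using i by simp
  qed
  \<comment> \<open>\<open>K i\<close> is compact and disjoint from \<open>\<phi> i\<close>, so the
    functional attains a maximum on it strictly below \<open>b (\<phi> i)\<close>. For empty
    \<open>K i\<close> any smaller number serves.\<close>
  have "\<exists>M<b (\<phi> i). \<forall>x\<in>K i. a (\<phi> i) \<bullet> x \<le> M" if i: "i \<in> {1..n}" for i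
  proof (cases "K i = {}")
    case True
    then show ?thesis
      by (intro exI[of _ "b (\<phi> i) - 1"]) auto
  next
    case False
    have "continuous_on (K i) (\<lambda>x. a (\<phi> i) \<bullet> x)"
      by (intro continuous_intros)
    from continuous_attains_sup[OF K_compact False this]
    obtain y where y: "y \<in> K i" "\<forall>x\<in>K i. a (\<phi> i) \<bullet> x \<le> a (\<phi> i) \<bullet> y"
      by blast
    have "y \<in> P" "y \<notin> \<phi> i"
      using y(1) K_sub disj[OF i] by blast+
    then have "a (\<phi> i) \<bullet> y < b (\<phi> i)"
      using facet_eq[OF \<phi>[OF i]] facet_le[OF \<phi>[OF i], of y] by force
    with y show ?thesis by blast
  qed
  then obtain M where M: "\<And>i. i \<in> {1..n} \<Longrightarrow> M i < b (\<phi> i)"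
    "\<And>i x. i \<in> {1..n} \<Longrightarrow> x \<in> K i \<Longrightarrow> a (\<phi> i) \<bullet> x \<le> M i"
    by metis
  text \<open>Choosing \<open>p\<close> close to \<open>V\<close> makes \<open>a (\<phi> i)\<close> increase from the other facets of color \<open>i\<close>
    to \<open>p\<close> and from \<open>p\<close> to \<open>\<phi> i\<close>, opposite to the sign of \<open>u i\<close>.\<close>
  let ?U = "\<Inter>i\<in>{1..n}. {x. M i < a (\<phi> i) \<bullet> x}"
  have "open ?U"
    using open_halfspace_gt by (intro open_INT) auto
  moreover have "V \<in> ?U"
  proof
    fix i assume i: "i \<in> {1..n}"
    have "a (\<phi> i) \<bullet> V = b (\<phi> i)"
      using facet_eq[OF \<phi>[OF i]] \<nu>(2)[OF i] by blast
    then show "V \<in> {x. M i < a (\<phi> i) \<bullet> x}"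
      using M(1)[OF i] by simp
  qed
  moreover have "V \<in> closure (rel_interior P)"
    using VP closure_subset convex_closure_rel_interior[OF polytope_imp_convex[OF poly]] by blast
  ultimately obtain p where p: "p \<in> rel_interior P" "p \<in> ?U"
    using open_Int_closure_eq_empty[of ?U "rel_interior P"] by blast
  obtain x c where x: "x \<in> rel_frontier P" and c: "c > 0" "x - p = c *\<^sub>R w x"
  proof (rule field_radial_on_boundary[OF p(1)])
    show "continuous_on P w"
      unfolding w_def
      by (intro continuous_on_sum continuous_on_scaleR continuous_on_const
          continuous_on_subset[OF u(1) subset_UNIV])
    show "w x \<in> directions P" for x
      unfolding w_def using e(1) \<phi> \<nu>(2) subspace_directions[OF VP]
      by (intro subspace_sum subspace_scale) auto
    show "w x \<noteq> 0" if xP: "x \<in> P" for x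
    proof -
      \<comment> \<open>Some set of the cover contains \<open>x\<close>, and the coordinate with its
        index is nonzero there.\<close>
      obtain i where "i \<in> {1..n}" "x \<in> X i"
        using xP assms(8) by blast
      then have "a (\<phi> i) \<bullet> w x \<noteq> 0"
        using aw u(4) by simp
      then show ?thesis by auto
    qed
  qed blast
  obtain j where j: "j \<in> {1..m}" "x \<in> F j"
    using x rel_frontier_eq facet_obtain by blast
  \<comment> \<open>The color of a facet through \<open>x\<close> selects the coordinate in which
    radiality fails.\<close>
  define i where "i = h j"
  have i: "i \<in> {1..n}"
    using assms(3) j(1) unfolding proper_coloring_def i_def by blast
  have diff: "a (\<phi> i) \<bullet> x - a (\<phi> i) \<bullet> p = c * u i x"
    using c(2) aw[OF i] by (metis inner_diff_right inner_scaleR_right)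
  show False
  proof (cases "F j = \<phi> i")
    \<comment> \<open>On \<open>\<phi> i\<close> the functional exceeds its value at
      \<open>p\<close>, whereas \<open>c * u i x = - c\<close> is negative.\<close>
    case True
    then have "x \<in> \<phi> i" using j by simp
    then have "u i x = -1" "a (\<phi> i) \<bullet> x = b (\<phi> i)"
      using u(2)[OF i] facet_eq[OF \<phi>[OF i]] by blast+
    then show False
      using diff rel_interior_less[OF p(1) \<phi>[OF i]] c(1) by simp
  next
    \<comment> \<open>On \<open>K i\<close> the functional stays below its value at
      \<open>p\<close>, whereas \<open>c * u i x = c\<close> is positive.\<close>
    case False
    then have "x \<in> K i" using j by (auto simp: K_def i_def)
    then have "u i x = 1" "a (\<phi> i) \<bullet> x \<le> M i"
      using u(3)[OF i] M(2)[OF i] by auto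
    moreover have "M i < a (\<phi> i) \<bullet> p"
      using p(2) i by blast
    ultimately show False
      using diff c(1) by simp
  qed
qed

end
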